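(* Suppose each $f_i:\mathbb{R}^d\to\mathbb{R}$ ($i\in[n]$) is convex and $L$-smooth, let $0<\alpha\le \frac{2}{L}$ and $\theta\in(0,1)$. Let $(x^t)_{t\ge 0}$ be generated by Prox-DFinito with step-size $\alpha$, damping parameter $\theta$, initialization $\boldsymbol{z}^0\in\mathbb{R}^{nd}$, and shuffling-once sampling (a uniformly random permutation $\pi$ of $[n]$ is drawn once before training begins and is then used as the cyclic order in all epochs). Then for every $k=0,1,2,\dots$ $$\mathbb{E}\,\min_{g\in\partial r(x^{kn})}\|\nabla F(x^{kn})+g\|^2\le \frac{C L^2}{(k+1)\theta(1-\theta)},\qquad C=\Big(\frac{2}{\alpha L}\Big)^2\frac{(n+1)(\log(n)+1)}{2n^2}\|\boldsymbol{z}^0-\boldsymbol{z}^\star\|^2 ,$$ where the expectation is over $\pi$.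
   Context: Problem: $\min_{x\in\mathbb{R}^d}F(x)+r(x)$ with $F=\frac1n\sum_{i=1}^n f_i$, each $f_i$ differentiable and convex, and $r:\mathbb{R}^d\to\mathbb{R}\cup\{+\infty\}$ convex, closed and proper (not necessarily differentiable), with subdifferential $\partial r$. $[n]=\{1,\dots,n\}$; $L>0$, and $L$-smooth means the gradient is $L$-Lipschitz. $\mathrm{prox}_{\alpha r}(x)=\arg\min_{y}\{\alpha r(y)+\frac12\|y-x\|^2\}$. $\|\cdot\|$ is the Euclidean norm. A minimizer $x^\star$ of $F+r$ is assumed to exist, and $\boldsymbol{z}^\star=\mathrm{col}\{z_1^\star,\dots,z_n^\star\}\in\mathbb{R}^{nd}$ (stacked vector) with $z_i^\star=x^\star-\alpha\nabla f_i(x^\star)$. Prox-DFinito: given (deterministic) $\boldsymbol{z}^0=\mathrm{col}\{z_1^0,\dots,z_n^0\}$, set $\bar z^0=\frac1n\sum_i z_i^0$. For each epoch $k=0,1,2,\dots$: for $t=kn+1,\dots,(k+1)n$, set $x^{t-1}=\mathrm{prox}_{\alpha r}(\bar z^{t-1})$, pick an index $i_t$, set $z_{i_t}^t=x^{t-1}-\alpha\nabla f_{i_t}(x^{t-1})$, $z_i^t=z_i^{t-1}$ for $i\ne i_t$, and $\bar z^t=\bar z^{t-1}+(z_{i_t}^t-z_{i_t}^{t-1})/n$. At the end of the epoch apply the damping step: overwrite $z_i^{(k+1)n}\leftarrow(1-\theta)z_i^{kn}+\theta z_i^{(k+1)n}$ for all $i$ and $\bar z^{(k+1)n}\leftarrow(1-\theta)\bar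 z^{kn}+\theta\bar z^{(k+1)n}$. Thus $x^{kn}=\mathrm{prox}_{\alpha r}(\bar z^{kn})$ with the damped $\bar z^{kn}$. Cyclic order $\pi$ means $i_{kn+j}=\pi(j)$ for all epochs $k$ and $j\in[n]$. *)

theory Defs
  imports "HOL-Probability.Probability" "HOL-Combinatorics.Permutations"
begin

definition grad :: "('a::real_inner \<Rightarrow> real) \<Rightarrow> 'a \<Rightarrow> 'a" where
  "grad f x = (THE D. GDERIV f x :> D)"

definition smooth_fun :: "real \<Rightarrow> ('a::real_inner \<Rightarrow> real) \<Rightarrow> bool" where
  "smooth_fun L f \<longleftrightarrow> (\<forall>x. f differentiable at x) \<and> L-lipschitz_on UNIV (grad f)"

definition ereal_epigraph :: "('a \<Rightarrow> ereal) \<Rightarrow> ('a \<times> real) set" where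
  "ereal_epigraph r = {(x, t). r x \<le> ereal t}"

definition convex_fun :: "('a::real_vector \<Rightarrow> ereal) \<Rightarrow> bool" where
  "convex_fun r \<longleftrightarrow> convex (ereal_epigraph r)"

definition closed_fun :: "('a::topological_space \<Rightarrow> ereal) \<Rightarrow> bool" where
  "closed_fun r \<longleftrightarrow> closed (ereal_epigraph r)"

definition proper_fun :: "('a \<Rightarrow> ereal) \<Rightarrow> bool" where
  "proper_fun r \<longleftrightarrow> (\<forall>x. r x \<noteq> -\<infinity>) \<and> (\<exists>x. r x \<noteq> \<infinity>)"

definition subdifferential :: "('a::real_inner \<Rightarrow> ereal) \<Rightarrow> 'a \<Rightarrow> 'a set" where
  "subdifferential r x = {g. \<forall>y. r x + ereal (g \<bullet> (y - x)) \<le> r y}"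

definition prox :: "real \<Rightarrow> ('a::real_normed_vector \<Rightarrow> ereal) \<Rightarrow> 'a \<Rightarrow> 'a" where
  "prox \<alpha> r x =
     arg_min (\<lambda>y. ereal \<alpha> * r y + ereal (1 / 2 * (norm (y - x))\<^sup>2)) (\<lambda>_. True)"

definition finite_sum_obj :: "nat \<Rightarrow> (nat \<Rightarrow> 'a \<Rightarrow> real) \<Rightarrow> 'a \<Rightarrow> real" where
  "finite_sum_obj n f x = (\<Sum>i = 1..n. f i x) / real n"

text \<open>
  The state of Prox-DFinito is a pair of the blocks \<open>z\<^sub>1, \<dots>, z\<^sub>n\<close>, stored as a function of
  which only the values on \<open>{1..n}\<close> matter, and the running average, which the algorithm
  updates separately. An index sequence \<open>\<iota>\<close> gives the index \<open>\<iota> t\<close> used at time \<open>t \<ge> 1\<close>.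
\<close>

type_synonym 'a dfinito_state = "(nat \<Rightarrow> 'a) \<times> 'a"

definition dfinito_init :: "nat \<Rightarrow> (nat \<Rightarrow> 'a::real_inner) \<Rightarrow> 'a dfinito_state" where
  "dfinito_init n z0 = (z0, (1 / real n) *\<^sub>R (\<Sum>i = 1..n. z0 i))"

definition dfinito_step ::
  "nat \<Rightarrow> (nat \<Rightarrow> 'a::real_inner \<Rightarrow> real) \<Rightarrow> ('a \<Rightarrow> ereal) \<Rightarrow> real \<Rightarrow> nat \<Rightarrow>
     'a dfinito_state \<Rightarrow> 'a dfinito_state" where
  "dfinito_step n f r \<alpha> i = (\<lambda>(z, zbar).
     let x = prox \<alpha> r zbar;
         zi = x - \<alpha> *\<^sub>R grad (f i) x
     in (z(i := zi), zbar + (1 / real n) *\<^sub>R (zi - z i)))"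

definition dfinito_damp ::
  "real \<Rightarrow> 'a::real_vector dfinito_state \<Rightarrow> 'a dfinito_state \<Rightarrow> 'a dfinito_state" where
  "dfinito_damp \<theta> = (\<lambda>(z, zbar) (z', zbar').
     (\<lambda>i. (1 - \<theta>) *\<^sub>R z i + \<theta> *\<^sub>R z' i, (1 - \<theta>) *\<^sub>R zbar + \<theta> *\<^sub>R zbar'))"

text \<open>\<open>dfinito_inner \<dots> k s j\<close>: the state after \<open>j\<close> undamped steps of epoch \<open>k\<close> started in \<open>s\<close>.\<close>

primrec dfinito_inner ::
  "nat \<Rightarrow> (nat \<Rightarrow> 'a::real_inner \<Rightarrow> real) \<Rightarrow> ('a \<Rightarrow> ereal) \<Rightarrow> real \<Rightarrow> (nat \<Rightarrow> nat) \<Rightarrow>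
     nat \<Rightarrow> 'a dfinito_state \<Rightarrow> nat \<Rightarrow> 'a dfinito_state" where
  "dfinito_inner n f r \<alpha> \<iota> k s 0 = s"
| "dfinito_inner n f r \<alpha> \<iota> k s (Suc j) =
     dfinito_step n f r \<alpha> (\<iota> (k * n + Suc j)) (dfinito_inner n f r \<alpha> \<iota> k s j)"

primrec dfinito_epoch ::
  "nat \<Rightarrow> (nat \<Rightarrow> 'a::real_inner \<Rightarrow> real) \<Rightarrow> ('a \<Rightarrow> ereal) \<Rightarrow> real \<Rightarrow> real \<Rightarrow> (nat \<Rightarrow> nat) \<Rightarrow>
     (nat \<Rightarrow> 'a) \<Rightarrow> nat \<Rightarrow> 'a dfinito_state" where
  "dfinito_epoch n f r \<alpha> \<theta> \<iota> z0 0 = dfinito_init n z0"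
| "dfinito_epoch n f r \<alpha> \<theta> \<iota> z0 (Suc k) =
     (let s = dfinito_epoch n f r \<alpha> \<theta> \<iota> z0 k
      in dfinito_damp \<theta> s (dfinito_inner n f r \<alpha> \<iota> k s n))"

text \<open>At times \<open>t = k * n\<close> the state is the damped one.\<close>

definition dfinito_x ::
  "nat \<Rightarrow> (nat \<Rightarrow> 'a::real_inner \<Rightarrow> real) \<Rightarrow> ('a \<Rightarrow> ereal) \<Rightarrow> real \<Rightarrow> real \<Rightarrow> (nat \<Rightarrow> nat) \<Rightarrow>
     (nat \<Rightarrow> 'a) \<Rightarrow> nat \<Rightarrow> 'a" where
  "dfinito_x n f r \<alpha> \<theta> \<iota> z0 t =
     prox \<alpha> r (snd (dfinito_inner n f r \<alpha> \<iota> (t div n)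
       (dfinito_epoch n f r \<alpha> \<theta> \<iota> z0 (t div n)) (t mod n)))"

text \<open>\<open>cyclic_order n p (k * n + j) = p j\<close> for \<open>j \<in> {1..n}\<close>; the value at time 0 is never used.\<close>

definition cyclic_order :: "nat \<Rightarrow> (nat \<Rightarrow> nat) \<Rightarrow> nat \<Rightarrow> nat" where
  "cyclic_order n p t = p ((t - 1) mod n + 1)"

text \<open>
  The squared distance from \<open>- \<nabla>F(x)\<close> to the subdifferential, as a minimum: \<^const>\<open>Least\<close>
  is unspecified when no minimum exists, so any bound on it requires attainment.
\<close>

definition min_subgrad_sq :: "('a::real_inner \<Rightarrow> real) \<Rightarrow> ('a \<Rightarrow> ereal) \<Rightarrow> 'a \<Rightarrow> real" where
  "min_subgrad_sq F r x =
     (LEAST m. m \<in> (\<lambda>g. (norm (grad F x + g))\<^sup>2) ` subdifferential r x)"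

end

theory Submission
  imports Defs
begin

text \<open>
  With \<open>G\<^sub>i y = x - \<alpha> \<nabla>f\<^sub>i x\<close> for \<open>x = prox \<alpha> r y\<close>, every step replaces a block
  \<open>z\<^sub>i\<close> by \<open>G\<^sub>i\<close> of the mean of all blocks, and \<open>G\<^sub>i\<close> is nonexpansive for \<open>\<alpha> \<le> 2 / L\<close>. Hence one
  undamped epoch with order \<open>\<pi>\<close> is a nonexpansive map \<open>T\<close> for the norm
  \<open>\<parallel>z\<parallel>\<^sub>\<pi>\<^sup>2 = \<Sum>\<^sub>l l \<parallel>z\<^bsub>\<pi>(l)\<^esub>\<parallel>\<^sup>2\<close>, with fixed point \<open>z\<^sup>\<star>\<close>, and the damping turns the iteration into a
  Krasnoselskii--Mann iteration, so \<open>\<parallel>T z - z\<parallel>\<^sub>\<pi>\<^sup>2\<close> decays like \<open>\<parallel>z\<^sup>0 - z\<^sup>\<star>\<parallel>\<^sub>\<pi>\<^sup>2 / ((k + 1) \<theta> (1 - \<theta>))\<close>.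
  The proximal step supplies the subgradient \<open>(y - x) / \<alpha>\<close>, and the corresponding residual
  \<open>\<nabla>F x + (y - x) / \<alpha>\<close> is \<open>1 / \<alpha>\<close> times \<open>y\<close> minus the mean of the \<open>G\<^sub>i y\<close>, which \<open>T z - z\<close> controls by
  Cauchy--Schwarz against the weights \<open>1 / l\<close>; their harmonic sum gives the factor \<open>ln n + 1\<close>. Averaging
  \<open>l \<parallel>z\<^bsub>\<pi>(l)\<^esub>\<parallel>\<^sup>2\<close> over \<open>\<pi>\<close> gives the factor \<open>(n + 1) / 2\<close>.
\<close>

subsection \<open>Smooth convex functions and proximal maps\<close>

lemma GDERIV_grad:
  fixes f :: "'a::euclidean_space \<Rightarrow> real"
  assumes "f differentiable at x"
  shows "GDERIV f x :> grad f x"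
proof -
  obtain D where D: "(f has_derivative D) (at x)"
    using assms unfolding differentiable_def by blast
  \<comment> \<open>In finite dimension \<open>adjoint D 1\<close> is the Riesz vector of the
    functional \<open>D\<close>. Together with uniqueness it gives the definite description in
    \<open>grad\<close> a meaning.\<close>
  have "D = (\<lambda>h. h \<bullet> adjoint D 1)"
    using adjoint_works[OF has_derivative_linear[OF D], of _ 1] by (simp add: fun_eq_iff)
  then have G: "GDERIV f x :> adjoint D 1"
    unfolding gderiv_def by (rule has_derivative_eq_rhs[OF D])
  have uniq: "E = adjoint D 1" if "GDERIV f x :> E" for E
  proof -
    have "(\<lambda>h. h \<bullet> E) = (\<lambda>h. h \<bullet> adjoint D 1)"
      using that G has_derivative_unique unfolding gderiv_def by blast
    then show ?thesis by (meson inner_commute vector_eq_ldot)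
  qed
  show ?thesis unfolding grad_def by (rule theI, rule G, rule uniq)
qed

lemma grad_eqI:
  fixes f :: "'a::euclidean_space \<Rightarrow> real"
  assumes "GDERIV f x :> D"
  shows "grad f x = D"
proof -
  have "f differentiable at x"
    using assms unfolding gderiv_def differentiable_def by blast
  then have "(\<lambda>h. h \<bullet> grad f x) = (\<lambda>h. h \<bullet> D)"
    using assms has_derivative_unique GDERIV_grad unfolding gderiv_def by blast
  then show ?thesis by (meson inner_commute vector_eq_ldot)
qed

lemma GDERIV_along_line:
  assumes "GDERIV f (x + t *\<^sub>R h) :> D"
  shows "((\<lambda>t. f (x + t *\<^sub>R h)) has_real_derivative h \<bullet> D) (at t)"
proof -
  have "((\<lambda>t. x + t *\<^sub>R h) has_derivative (\<lambda>s. s *\<^sub>R h)) (at t)"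
    by (auto intro!: derivative_eq_intros)
  from has_derivative_compose[OF this assms[unfolded gderiv_def]]
  show ?thesis by (simp add: has_field_derivative_def mult.commute[of _ "h \<bullet> D"])
qed

lemma GDERIV_tendsto_at_right:
  assumes "GDERIV f x :> D"
  shows "((\<lambda>t. (f (x + t *\<^sub>R h) - f x) / t) \<longlongrightarrow> h \<bullet> D) (at_right 0)"
proof -
  have "((\<lambda>t. f (x + t *\<^sub>R h)) has_real_derivative h \<bullet> D) (at 0)"
    by (rule GDERIV_along_line) (use assms in simp)
  then have "(\<lambda>t. (f (x + t *\<^sub>R h) - f x) / t) \<midarrow>0\<rightarrow> h \<bullet> D"
    by (simp add: DERIV_def)
  then show ?thesis
    by (rule tendsto_within_subset) simp
qed

text \<open>Convexity on the segment bounds the difference quotient at every \<open>t\<close> in (0,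
  1) by \<open>f y - f x\<close>; the limit as \<open>t\<close> tends to 0 from the right gives the
  tangent inequality.\<close>

lemma convex_on_gradient_ineq:
  assumes "convex_on UNIV f" "GDERIV f x :> D"
  shows "f x + (y - x) \<bullet> D \<le> f y"
proof -
  have "(y - x) \<bullet> D \<le> f y - f x"
  proof (rule tendsto_upperbound[OF GDERIV_tendsto_at_right[OF assms(2)]])
    show "\<forall>\<^sub>F t in at_right 0. (f (x + t *\<^sub>R (y - x)) - f x) / t \<le> f y - f x"
      unfolding eventually_at_right_field
    proof (intro exI[of _ 1] conjI allI impI)
      fix t :: real assume t: "0 < t" "t < 1"
      have "f ((1 - t) *\<^sub>R x + t *\<^sub>R y) \<le> (1 - t) * f x + t * f y"
        using assms(1) t by (simp add: convex_on_def)
      moreover have "(1 - t) *\<^sub>R x + t *\<^sub>R y = x + t *\<^sub>R (y - x)"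
        by (simp add: algebra_simps)
      ultimately show "(f (x + t *\<^sub>R (y - x)) - f x) / t \<le> f y - f x"
        using t by (simp add: field_simps)
    qed simp
  qed simp
  then show ?thesis by simp
qed

lemma smooth_fun_descent:
  fixes f :: "'a::euclidean_space \<Rightarrow> real"
  assumes "smooth_fun L f"
  shows "f (x + h) \<le> f x + h \<bullet> grad f x + L / 2 * (norm h)\<^sup>2"
proof -
  \<comment> \<open>\<open>\<psi>\<close> is \<open>f\<close> on the segment minus the linear and
    quadratic parts of the bound. The Lipschitz gradient makes its derivative nonpositive, so
    comparing the endpoints 0 and 1 suffices.\<close>
  define \<psi> where "\<psi> = (\<lambda>t. f (x + t *\<^sub>R h) - t * (h \<bullet> grad f x) - L / 2 * t\<^sup>2 * (norm h)\<^sup>2)"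
  have "\<psi> 1 \<le> \<psi> 0"
  proof (rule DERIV_nonpos_imp_nonincreasing[where f = \<psi>])
    fix t :: real assume t: "0 \<le> t" "t \<le> 1"
    have diff: "f differentiable at (x + t *\<^sub>R h)"
      using assms by (simp add: smooth_fun_def)
    have "norm (grad f (x + t *\<^sub>R h) - grad f x) \<le> L * (t * norm h)"
      using assms lipschitz_onD[of L UNIV "grad f" "x + t *\<^sub>R h" x] t
      by (simp add: smooth_fun_def dist_norm)
    then have "h \<bullet> (grad f (x + t *\<^sub>R h) - grad f x) \<le> norm h * (L * (t * norm h))"
      by (meson dual_order.trans mult_left_mono norm_cauchy_schwarz norm_ge_zero)
    then have "h \<bullet> grad f (x + t *\<^sub>R h) - h \<bullet> grad f x - L * t * (norm h)\<^sup>2 \<le> 0"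
      by (simp add: inner_diff_right power2_eq_square algebra_simps)
    moreover have "DERIV \<psi> t :> h \<bullet> grad f (x + t *\<^sub>R h) - h \<bullet> grad f x - L * t * (norm h)\<^sup>2"
      unfolding \<psi>_def by (rule derivative_eq_intros GDERIV_along_line GDERIV_grad diff refl)+ simp
    ultimately show "\<exists>y. DERIV \<psi> t :> y \<and> y \<le> 0" by blast
  qed simp
  then show ?thesis by (simp add: \<psi>_def)
qed

text \<open>Baillon--Haddad: minimise the tilted function \<open>y \<mapsto> f y - y \<bullet> \<nabla>f x\<close> by one gradient step
  from \<open>y\<close>.\<close>

lemma smooth_convex_gap:
  fixes f :: "'a::euclidean_space \<Rightarrow> real"
  assumes "smooth_fun L f" "convex_on UNIV f" "L > 0"
  shows "f x + (y - x) \<bullet> grad f x + (norm (grad f y - grad f x))\<^sup>2 / (2 * L) \<le> f y"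
proof -
  define d where "d = grad f y - grad f x"
  define w where "w = y - (1 / L) *\<^sub>R d"
  have "f x + (w - x) \<bullet> grad f x \<le> f w"
    using assms convex_on_gradient_ineq GDERIV_grad by (metis smooth_fun_def)
  moreover have "f w \<le> f y + (norm d)\<^sup>2 / (2 * L) - (1 / L) * (d \<bullet> grad f y)"
  proof -
    have "L / 2 * (norm (- (1 / L) *\<^sub>R d))\<^sup>2 = (norm d)\<^sup>2 / (2 * L)"
      using assms(3) by (simp add: power2_eq_square field_simps)
    then show ?thesis
      using smooth_fun_descent[OF assms(1), of y "- (1 / L) *\<^sub>R d"] by (simp add: w_def)
  qed
  moreover have "(w - x) \<bullet> grad f x = (y - x) \<bullet> grad f x - (1 / L) * (d \<bullet> grad f x)"
    by (simp add: w_def inner_diff_left)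
  moreover have "(norm d)\<^sup>2 = d \<bullet> grad f y - d \<bullet> grad f x"
    unfolding power2_norm_eq_inner by (simp add: d_def inner_diff_right)
  then have "(norm d)\<^sup>2 / L = (1 / L) * (d \<bullet> grad f y) - (1 / L) * (d \<bullet> grad f x)"
    by (simp add: diff_divide_distrib)
  moreover have "(norm d)\<^sup>2 / L = 2 * ((norm d)\<^sup>2 / (2 * L))" by simp
  ultimately show ?thesis unfolding d_def by linarith
qed

text \<open>Adding the gap inequality to itself with \<open>x\<close> and \<open>y\<close> exchanged
  gives cocoercivity, \<open>(norm d)\<^sup>2 / L \<le> (x - y) \<bullet> d\<close>. For
  \<open>\<alpha> \<le> 2 / L\<close> the cross term of the squared norm then absorbs the quadratic
  one.\<close>

lemma gradient_step_nonexpansive: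
  fixes f :: "'a::euclidean_space \<Rightarrow> real"
  assumes "smooth_fun L f" "convex_on UNIV f" "L > 0" "0 < \<alpha>" "\<alpha> \<le> 2 / L"
  shows "norm ((x - \<alpha> *\<^sub>R grad f x) - (y - \<alpha> *\<^sub>R grad f y)) \<le> norm (x - y)"
proof -
  define d where "d = grad f x - grad f y"
  have 1: "f x + (y - x) \<bullet> grad f x + (norm d)\<^sup>2 / (2 * L) \<le> f y"
    using smooth_convex_gap[OF assms(1-3), of x y] by (simp add: d_def norm_minus_commute)
  have 2: "f y + (x - y) \<bullet> grad f y + (norm d)\<^sup>2 / (2 * L) \<le> f x"
    using smooth_convex_gap[OF assms(1-3), of y x] by (simp add: d_def)
  have 3: "(norm d)\<^sup>2 / (2 * L) + (norm d)\<^sup>2 / (2 * L) = (norm d)\<^sup>2 / L" by simp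
  have 4: "(x - y) \<bullet> d = - ((y - x) \<bullet> grad f x) - (x - y) \<bullet> grad f y"
    by (simp add: d_def algebra_simps)
  have coc: "(norm d)\<^sup>2 / L \<le> (x - y) \<bullet> d"
    using 1 2 3 4 by linarith
  have "\<alpha> * (norm d)\<^sup>2 \<le> 2 / L * (norm d)\<^sup>2"
    using assms(5) by (rule mult_right_mono) simp
  also have "\<dots> \<le> 2 * ((x - y) \<bullet> d)" using coc by simp
  finally have "\<alpha> * (\<alpha> * (norm d)\<^sup>2) \<le> \<alpha> * (2 * ((x - y) \<bullet> d))"
    using assms(4) by simp
  moreover have "(norm ((x - y) - \<alpha> *\<^sub>R d))\<^sup>2
      = (norm (x - y))\<^sup>2 - \<alpha> * (2 * ((x - y) \<bullet> d)) + \<alpha> * (\<alpha> * (norm d)\<^sup>2)"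
    unfolding power2_norm_eq_inner
    by (simp add: inner_diff_left inner_diff_right inner_commute algebra_simps)
  ultimately have "(norm ((x - y) - \<alpha> *\<^sub>R d))\<^sup>2 \<le> (norm (x - y))\<^sup>2" by linarith
  then have "norm ((x - y) - \<alpha> *\<^sub>R d) \<le> norm (x - y)"
    by (rule power2_le_imp_le) simp
  moreover have "(x - \<alpha> *\<^sub>R grad f x) - (y - \<alpha> *\<^sub>R grad f y) = (x - y) - \<alpha> *\<^sub>R d"
    by (simp add: d_def algebra_simps)
  ultimately show ?thesis by (simp only:)
qed

section \<open>Subdifferentials and the proximal map\<close>

lemma convex_funD:
  assumes "convex_fun r" "r x \<le> ereal a" "r y \<le> ereal b" "0 \<le> t" "t \<le> 1"
  shows "r ((1 - t) *\<^sub>R x + t *\<^sub>R y) \<le> ereal ((1 - t) * a + t * b)"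
proof -
  have "(1 - t) *\<^sub>R (x, a) + t *\<^sub>R (y, b) \<in> ereal_epigraph r"
    using assms by (intro convexD) (auto simp: convex_fun_def ereal_epigraph_def)
  then show ?thesis by (simp add: ereal_epigraph_def)
qed

text \<open>Fermat's rule for a smooth plus a convex term: moving a fraction \<open>t\<close> from
  \<open>p\<close> towards \<open>y\<close>, minimality forces \<open>F\<close> to change by at
  least \<open>t * (r p - r y)\<close>, and dividing by \<open>t\<close> leaves the derivative. It
  serves both for \<open>xstar\<close> and for the proximal objective.\<close>

lemma subdifferential_minimizer:
  fixes p :: "'a::real_inner"
  assumes "convex_fun r" "proper_fun r" "GDERIV F p :> D"
    and min: "\<And>y. ereal (F p) + r p \<le> ereal (F y) + r y"
  shows "- D \<in> subdifferential r p" and "\<bar>r p\<bar> \<noteq> \<infinity>"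
proof -
  obtain y0 b0 where "r y0 = ereal b0"
    using assms(2) unfolding proper_fun_def by (metis ereal_cases)
  then obtain a where a: "r p = ereal a"
    using min[of y0] assms(2) unfolding proper_fun_def by (cases "r p") auto
  then show "\<bar>r p\<bar> \<noteq> \<infinity>" by simp
  have "r p + ereal ((- D) \<bullet> (y - p)) \<le> r y" for y
  proof (cases "r y")
    case (real b)
    have "a - b \<le> (y - p) \<bullet> D"
    proof (rule tendsto_lowerbound[OF GDERIV_tendsto_at_right[OF assms(3)]])
      show "\<forall>\<^sub>F t in at_right 0. a - b \<le> (F (p + t *\<^sub>R (y - p)) - F p) / t"
        unfolding eventually_at_right_field
      proof (intro exI[of _ 1] conjI allI impI)
        fix t :: real assume t: "0 < t" "t < 1"
        have eq: "(1 - t) *\<^sub>R p + t *\<^sub>R y = p + t *\<^sub>R (y - p)"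
          by (simp add: algebra_simps)
        have "r (p + t *\<^sub>R (y - p)) \<le> ereal ((1 - t) * a + t * b)"
          using convex_funD[OF assms(1), of p a y b t] a real t by (simp add: eq)
        then have "ereal (F p) + r p \<le> ereal (F (p + t *\<^sub>R (y - p))) + ereal ((1 - t) * a + t * b)"
          by (meson min add_left_mono order_trans)
        then have "F p + a \<le> F (p + t *\<^sub>R (y - p)) + (1 - t) * a + t * b"
          by (simp add: a)
        then show "a - b \<le> (F (p + t *\<^sub>R (y - p)) - F p) / t"
          using t by (simp add: field_simps)
      qed simp
    qed simp
    then show ?thesis by (simp add: a real inner_commute)
  qed (use assms(2) in \<open>auto simp: proper_fun_def\<close>)
  then show "- D \<in> subdifferential r p" by (simp add: subdifferential_def)
qed

lemma subdifferential_monotone: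
  assumes "g \<in> subdifferential r x" "h \<in> subdifferential r y"
    and "\<bar>r x\<bar> \<noteq> \<infinity>" "\<bar>r y\<bar> \<noteq> \<infinity>"
  shows "0 \<le> (g - h) \<bullet> (x - y)"
proof -
  obtain a b where ab: "r x = ereal a" "r y = ereal b"
    using assms(3,4) by fastforce
  have "r x + ereal (g \<bullet> (y - x)) \<le> r y" "r y + ereal (h \<bullet> (x - y)) \<le> r x"
    using assms(1,2) by (auto simp: subdifferential_def)
  then show ?thesis by (simp add: ab algebra_simps)
qed

text \<open>\<open>prox\<close> is a choice made by \<open>arg_min\<close>, so a minimizer has to be
  shown to exist before anything can be said about it. The affine minorant given by \<open>g\<close>
  at \<open>x0\<close> supplies coercivity; Fermat's rule then yields the subgradient.\<close>

lemma prox_subgradient: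
  fixes r :: "'a::euclidean_space \<Rightarrow> ereal"
  assumes "convex_fun r" "closed_fun r" "proper_fun r" "0 < \<alpha>"
    and minorant: "g \<in> subdifferential r x0" "\<bar>r x0\<bar> \<noteq> \<infinity>"
  shows "(1 / \<alpha>) *\<^sub>R (x - prox \<alpha> r x) \<in> subdifferential r (prox \<alpha> r x)"
    and "\<bar>r (prox \<alpha> r x)\<bar> \<noteq> \<infinity>"
proof -
  define \<phi> where "\<phi> = (\<lambda>y. ereal \<alpha> * r y + ereal (1 / 2 * (norm (y - x))\<^sup>2))"
  \<comment> \<open>Passing to pairs in the epigraph replaces an extended-real, merely lower
    semicontinuous objective by a continuous one on a closed set.\<close>
  define \<Phi> where "\<Phi> = (\<lambda>(y, t). \<alpha> * t + 1 / 2 * (norm (y - x))\<^sup>2)"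
  obtain a where a: "r x0 = ereal a" using minorant(2) by fastforce
  have low: "a + g \<bullet> (y - x0) \<le> t" if "r y \<le> ereal t" for y t
  proof -
    have "r x0 + ereal (g \<bullet> (y - x0)) \<le> ereal t"
      using minorant(1) that unfolding subdifferential_def by (blast intro: order_trans)
    then show ?thesis by (simp add: a)
  qed
  define M where "M = \<Phi> (x0, a)"
  define S where "S = ereal_epigraph r \<inter> {q. \<Phi> q \<le> M}"
  have cont: "continuous_on A \<Phi>" for A
    unfolding \<Phi>_def case_prod_unfold by (intro continuous_intros)
  have "closed {q. \<Phi> q \<le> M}"
    by (intro closed_Collect_le cont continuous_on_const)
  then have "closed S"
    using assms(2) unfolding S_def closed_fun_def by (intro closed_Int)
  moreover have "bounded S"
  proof -
    \<comment> \<open>The minorant turns \<open>\<Phi> (y, t) \<le> M\<close> into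
      \<open>s\<^sup>2 \<le> 2 * c + 2 * \<alpha> * norm g * s\<close> for
      \<open>s = norm (y - x)\<close>. The summand 1 in \<open>R\<close> makes \<open>s > R\<close>
      imply \<open>s \<ge> 1\<close>, so that cancelling a factor \<open>s\<close> gives a
      contradiction.\<close>
    define c where "c = M - \<alpha> * (a + g \<bullet> (x - x0))"
    define R where "R = 2 * \<alpha> * norm g + \<bar>2 * c\<bar> + 1"
    define B where "B = \<bar>a\<bar> + norm g * (R + norm (x - x0))"
    have "norm (y - x) \<le> R \<and> -B \<le> t \<and> t \<le> \<bar>M\<bar> / \<alpha>" if "(y, t) \<in> S" for y t
    proof -
      let ?s = "norm (y - x)"
      have rt: "r y \<le> ereal t" and le: "\<alpha> * t + 1 / 2 * ?s\<^sup>2 \<le> M"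
        using that by (auto simp: S_def ereal_epigraph_def \<Phi>_def)
      have lt: "a + g \<bullet> (y - x0) \<le> t" by (rule low[OF rt])
      have "g \<bullet> (y - x0) = g \<bullet> (x - x0) + g \<bullet> (y - x)"
        by (simp add: algebra_simps)
      moreover have "- (norm g * ?s) \<le> g \<bullet> (y - x)"
        using Cauchy_Schwarz_ineq2[of g "y - x"] by linarith
      ultimately have "a + g \<bullet> (x - x0) - norm g * ?s \<le> t" using lt by linarith
      then have "\<alpha> * (a + g \<bullet> (x - x0) - norm g * ?s) \<le> \<alpha> * t"
        using assms(4) by simp
      then have q: "?s\<^sup>2 \<le> 2 * c + 2 * \<alpha> * norm g * ?s"
        using le by (simp add: c_def algebra_simps)
      have sR: "?s \<le> R"
      proof (rule ccontr)
        assume "\<not> ?s \<le> R"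
        moreover have "0 \<le> 2 * \<alpha> * norm g" using assms(4) by simp
        then have "1 \<le> R" unfolding R_def by linarith
        ultimately have s: "?s > R" "?s \<ge> 1" by linarith+
        have "2 * c \<le> \<bar>2 * c\<bar> * ?s"
          using s(2) by (metis abs_ge_self abs_ge_zero dual_order.trans mult.right_neutral mult_left_mono)
        then have "?s * ?s \<le> (2 * \<alpha> * norm g + \<bar>2 * c\<bar>) * ?s"
          using q by (simp add: power2_eq_square algebra_simps)
        then have "?s \<le> 2 * \<alpha> * norm g + \<bar>2 * c\<bar>"
          by (rule mult_right_le_imp_le) (use s(2) in linarith)
        then show False using s by (simp add: R_def)
      qed
      have "norm (y - x0) \<le> R + norm (x - x0)"
        using norm_triangle_ineq[of "y - x" "x - x0"] sR by simp
      then have "norm g * norm (y - x0) \<le> norm g * (R + norm (x - x0))"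
        by (rule mult_left_mono) simp
      moreover have "- (norm g * norm (y - x0)) \<le> g \<bullet> (y - x0)"
        using Cauchy_Schwarz_ineq2[of g "y - x0"] by linarith
      ultimately have "-B \<le> t" using lt unfolding B_def by linarith
      moreover have "\<alpha> * t \<le> \<bar>M\<bar>"
        using le zero_le_power2[of ?s] by linarith
      then have "t \<le> \<bar>M\<bar> / \<alpha>" using assms(4) by (simp add: field_simps)
      ultimately show ?thesis using sR by blast
    qed
    then have "S \<subseteq> cball x R \<times> {-B..\<bar>M\<bar> / \<alpha>}"
      by (auto simp: dist_norm norm_minus_commute)
    then show ?thesis
      by (rule bounded_subset[rotated]) (intro bounded_Times bounded_cball bounded_closed_interval)
  qed
  ultimately have "compact S" by (simp add: compact_eq_bounded_closed)
  moreover have "(x0, a) \<in> S" by (simp add: S_def M_def ereal_epigraph_def a)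
  ultimately obtain q where q: "q \<in> S" "\<And>q'. q' \<in> S \<Longrightarrow> \<Phi> q \<le> \<Phi> q'"
    using continuous_attains_inf[OF _ _ cont, of S] by blast
  obtain p t where pt: "q = (p, t)" by fastforce
  have rp: "r p \<le> ereal t" using q(1) by (simp add: pt S_def ereal_epigraph_def)
  have "is_arg_min \<phi> (\<lambda>_. True) p"
    unfolding is_arg_min_def
  proof (intro conjI notI)
    assume "\<exists>y. True \<and> \<phi> y < \<phi> p"
    then obtain y where y: "\<phi> y < \<phi> p" by blast
    obtain c where c: "r p = ereal c"
      using rp assms(3) unfolding proper_fun_def by (cases "r p") auto
    then obtain b where b: "r y = ereal b"
      using y assms(3,4) unfolding proper_fun_def \<phi>_def by (cases "r y") auto
    have "\<Phi> (y, b) < \<Phi> (p, c)" using y by (simp add: \<phi>_def \<Phi>_def b c)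
    also have "\<dots> \<le> \<Phi> (p, t)" using rp assms(4) by (simp add: c \<Phi>_def)
    finally have lt: "\<Phi> (y, b) < \<Phi> q" by (simp add: pt)
    then have "(y, b) \<in> S" using q(1) by (simp add: S_def ereal_epigraph_def b)
    then show False using lt q(2) by fastforce
  qed simp
  then have arg: "is_arg_min \<phi> (\<lambda>_. True) (prox \<alpha> r x)"
    unfolding prox_def arg_min_def \<phi>_def by (rule someI)
  define p where "p = prox \<alpha> r x"
  \<comment> \<open>The quadratic is divided by \<open>\<alpha>\<close> so that \<open>r\<close>
    enters with coefficient 1, as Fermat's rule requires.\<close>
  define F where "F = (\<lambda>y. 1 / (2 * \<alpha>) * ((y - x) \<bullet> (y - x)))"
  have min: "ereal (F p) + r p \<le> ereal (F y) + r y" for y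
  proof -
    have "\<phi> z = ereal \<alpha> * r z + ereal (\<alpha> * F z)" for z
      using assms(4) by (simp add: \<phi>_def F_def power2_norm_eq_inner)
    moreover have "\<phi> p \<le> \<phi> y" using arg by (simp add: is_arg_min_def p_def not_less)
    ultimately show ?thesis
      using assms(3,4)
      by (cases "r p"; cases "r y")
        (auto simp: proper_fun_def add.commute simp flip: distrib_left)
  qed
  have "GDERIV F p :> (1 / \<alpha>) *\<^sub>R (p - x)"
    using assms(4) unfolding gderiv_def F_def
    by (auto intro!: derivative_eq_intros simp: inner_commute)
  note res = subdifferential_minimizer[OF assms(1,3) this min]
  show "\<bar>r (prox \<alpha> r x)\<bar> \<noteq> \<infinity>" using res(2) by (simp add: p_def)
  show "(1 / \<alpha>) *\<^sub>R (x - prox \<alpha> r x) \<in> subdifferential r (prox \<alpha> r x)"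
    using res(1) by (simp add: p_def scaleR_diff_right)
qed

text \<open>Monotonicity gives firm nonexpansiveness, then Cauchy-Schwarz applies. Stated for any
  pairs satisfying the optimality condition, so that with \<open>x = y\<close> it also shows that
  the proximal point is the only one satisfying it.\<close>

lemma resolvent_nonexpansive:
  assumes "(1 / \<alpha>) *\<^sub>R (x - p) \<in> subdifferential r p" "\<bar>r p\<bar> \<noteq> \<infinity>"
    and "(1 / \<alpha>) *\<^sub>R (y - q) \<in> subdifferential r q" "\<bar>r q\<bar> \<noteq> \<infinity>"
    and "0 < \<alpha>"
  shows "norm (p - q) \<le> norm (x - y)"
proof -
  have "0 \<le> (1 / \<alpha>) * (((x - p) - (y - q)) \<bullet> (p - q))"
    using subdifferential_monotone[OF assms(1,3,2,4)]
    by (simp flip: scaleR_diff_right)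
  moreover have "(x - p) - (y - q) = (x - y) - (p - q)" by simp
  ultimately have "0 \<le> ((x - y) - (p - q)) \<bullet> (p - q)"
    using assms(5) by (simp only: zero_le_mult_iff) auto
  then have "norm (p - q) * norm (p - q) \<le> (x - y) \<bullet> (p - q)"
    by (simp add: inner_diff_left flip: power2_norm_eq_inner power2_eq_square)
  also have "\<dots> \<le> norm (x - y) * norm (p - q)" by (rule norm_cauchy_schwarz)
  finally show ?thesis by (cases "p = q") auto
qed

text \<open>The subdifferential is an intersection of closed sets and contains \<open>g\<close>, so
  it has a point nearest to \<open>- grad F x\<close>. Hence the minimum is attained and
  \<open>Least\<close> denotes it.\<close>

lemma min_subgrad_sq_le:
  fixes r :: "'a::euclidean_space \<Rightarrow> ereal"
  assumes "g \<in> subdifferential r x" "\<bar>r x\<bar> \<noteq> \<infinity>"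
  shows "min_subgrad_sq F r x \<le> (norm (grad F x + g))\<^sup>2"
proof -
  let ?S = "subdifferential r x"
  obtain a where a: "r x = ereal a" using assms(2) by fastforce
  have "?S = (\<Inter>y. {g. ereal (a + g \<bullet> (y - x)) \<le> r y})"
    by (auto simp: subdifferential_def a)
  moreover have "closed {g. ereal (a + g \<bullet> (y - x)) \<le> r y}" for y
  proof (cases "r y")
    case (real b)
    then show ?thesis by (auto intro!: closed_Collect_le continuous_intros)
  qed auto
  ultimately have "closed ?S" by auto
  then obtain g0 where g0: "g0 \<in> ?S" "\<And>h. h \<in> ?S \<Longrightarrow> dist (- grad F x) g0 \<le> dist (- grad F x) h"
    using distance_attains_inf[of ?S "- grad F x"] assms(1) by blast
  have dist: "dist (- grad F x) h = norm (grad F x + h)" for h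
    by (metis add.commute diff_minus_eq_add dist_commute dist_norm)
  have "min_subgrad_sq F r x = (norm (grad F x + g0))\<^sup>2"
    unfolding min_subgrad_sq_def
    by (rule Least_equality) (use g0 in \<open>auto simp: dist power_mono\<close>)
  also have "\<dots> \<le> (norm (grad F x + g))\<^sup>2"
    using g0(2)[OF assms(1)] by (simp add: dist power_mono)
  finally show ?thesis .
qed

subsection \<open>Cyclic sweeps and averaged iterations\<close>

lemma norm_sq_mean_le:
  fixes a :: "'i \<Rightarrow> 'a::real_inner"
  shows "(norm ((1 / real (card I)) *\<^sub>R (\<Sum>i\<in>I. a i)))\<^sup>2
    \<le> (1 / real (card I)) * (\<Sum>i\<in>I. (norm (a i))\<^sup>2)"
proof (cases "card I = 0")
  case False
  let ?N = "real (card I)"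
  have "(norm (\<Sum>i\<in>I. a i))\<^sup>2 \<le> (\<Sum>i\<in>I. norm (a i))\<^sup>2"
    by (intro power_mono norm_sum) simp
  also have "\<dots> \<le> (\<Sum>i\<in>I. (norm (a i))\<^sup>2) * ?N" by (rule sum_squared_le_sum_of_squares)
  finally have "(norm (\<Sum>i\<in>I. a i))\<^sup>2 / ?N\<^sup>2 \<le> (\<Sum>i\<in>I. (norm (a i))\<^sup>2) * ?N / ?N\<^sup>2"
    by (rule divide_right_mono) simp
  then show ?thesis using False by (simp add: power_divide power2_eq_square)
qed simp

lemma sum_split_at:
  fixes c :: "nat \<Rightarrow> 'a::comm_monoid_add"
  assumes "j \<in> {1..n}"
  shows "(\<Sum>l=1..n. c l) = (\<Sum>l=1..<j. c l) + (\<Sum>l=j..n. c l)"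
  using assms by (subst sum.union_disjoint[symmetric]) (auto intro!: sum.cong)

text \<open>Exchange of summation: \<open>l\<close> lies strictly below exactly \<open>n - l\<close>
  of the indices \<open>j\<close> up to \<open>n\<close>.\<close>

lemma sum_triangle_below:
  fixes h :: "nat \<Rightarrow> 'a::semiring_1"
  shows "(\<Sum>j=1..n. \<Sum>l=1..<j. h l) = (\<Sum>l=1..n. of_nat (n - l) * h l)"
proof (induction n)
  case (Suc n)
  have "(\<Sum>l=1..n. of_nat (Suc n - l) * h l) = (\<Sum>l=1..n. of_nat (n - l) * h l + h l)"
    by (rule sum.cong) (auto simp: Suc_diff_le algebra_simps)
  then show ?case using Suc by (simp add: sum.distrib atLeastLessThanSuc_atLeastAtMost)
qed simp

lemma sum_triangle_above:
  fixes h :: "nat \<Rightarrow> 'a::semiring_1"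
  shows "(\<Sum>j=1..n. \<Sum>l=j..n. h l) = (\<Sum>l=1..n. of_nat l * h l)"
proof (induction n)
  case (Suc n)
  have "(\<Sum>j=1..n. \<Sum>l=j..Suc n. h l) = (\<Sum>j=1..n. (\<Sum>l=j..n. h l) + h (Suc n))"
    by (rule sum.cong) auto
  then show ?case using Suc by (simp add: sum.distrib algebra_simps)
qed simp

text \<open>One sweep replaces the blocks \<open>u\<close> by \<open>v\<close> one after the other, each new block being controlled
  by the mean of the current ones. Summing over the sweep leaves each \<open>\<parallel>v l\<parallel>\<^sup>2\<close> counted \<open>n - l\<close> times
  on the right, and this is what singles out the weights \<open>l\<close>.\<close>

lemma sweep_nonexpansive:
  fixes u v :: "nat \<Rightarrow> 'a::real_inner"
  assumes "\<And>j. j \<in> {1..n} \<Longrightarrow>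
    norm (v j) \<le> norm ((1 / real n) *\<^sub>R ((\<Sum>l=1..<j. v l) + (\<Sum>l=j..n. u l)))"
  shows "(\<Sum>l=1..n. real l * (norm (v l))\<^sup>2) \<le> (\<Sum>l=1..n. real l * (norm (u l))\<^sup>2)"
proof (cases "n = 0")
  case False
  define V U where "V = (\<lambda>l. (norm (v l))\<^sup>2)" and "U = (\<lambda>l. (norm (u l))\<^sup>2)"
  have step: "V j \<le> (1 / real n) * ((\<Sum>l=1..<j. V l) + (\<Sum>l=j..n. U l))" if j: "j \<in> {1..n}" for j
  proof -
    \<comment> \<open>The blocks as they stand just before step \<open>j\<close>: new ones below
      \<open>j\<close>, old ones from \<open>j\<close> on.\<close>
    define a where "a = (\<lambda>l. if l < j then v l else u l)"
    have "(\<Sum>l=1..n. a l) = (\<Sum>l=1..<j. v l) + (\<Sum>l=j..n. u l)"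
      unfolding sum_split_at[OF j, of a] by (simp add: a_def)
    moreover have "(\<Sum>l=1..n. (norm (a l))\<^sup>2) = (\<Sum>l=1..<j. V l) + (\<Sum>l=j..n. U l)"
      unfolding sum_split_at[OF j, of "\<lambda>l. (norm (a l))\<^sup>2"] by (simp add: a_def V_def U_def)
    moreover have "V j \<le> (norm ((1 / real n) *\<^sub>R ((\<Sum>l=1..<j. v l) + (\<Sum>l=j..n. u l))))\<^sup>2"
      unfolding V_def by (intro power_mono assms j) simp
    ultimately show ?thesis using norm_sq_mean_le[of "{1..n}" a] by simp
  qed
  have "(\<Sum>j=1..n. V j) \<le> (\<Sum>j=1..n. (1 / real n) * ((\<Sum>l=1..<j. V l) + (\<Sum>l=j..n. U l)))"
    by (rule sum_mono) (rule step)
  also have "\<dots> = (1 / real n) * ((\<Sum>l=1..n. real (n - l) * V l) + (\<Sum>l=1..n. real l * U l))"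
    unfolding sum_distrib_left[symmetric] sum.distrib sum_triangle_below sum_triangle_above by simp
  finally have "real n * (\<Sum>j=1..n. V j) \<le> (\<Sum>l=1..n. real (n - l) * V l) + (\<Sum>l=1..n. real l * U l)"
    using False by (simp add: field_simps)
  \<comment> \<open>Writing \<open>n\<close> as \<open>(n - l) + l\<close> produces the same
    \<open>n - l\<close> sum as in the bound; it cancels and leaves weights \<open>l\<close> on both
    sides.\<close>
  moreover have "real n * (\<Sum>j=1..n. V j) = (\<Sum>l=1..n. real (n - l) * V l) + (\<Sum>l=1..n. real l * V l)"
    unfolding sum.distrib[symmetric] sum_distrib_left
    by (rule sum.cong) (auto simp: of_nat_diff algebra_simps)
  ultimately show ?thesis by (simp add: V_def U_def)
qed simp

text \<open>The sequence \<open>harm n - ln n\<close> is nonincreasing from \<open>n = 1\<close>,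
  where it equals 1.\<close>

lemma sum_inverse_le_ln:
  assumes "n \<ge> 1"
  shows "(\<Sum>l=1..n. 1 / real l) \<le> ln (real n) + 1"
proof -
  have "harm n - ln (real n) \<le> harm 1 - ln (real 1)"
    using assms by (intro euler_mascheroni_sequence_decreasing) auto
  then show ?thesis by (simp add: harm_def inverse_eq_divide)
qed

text \<open>Here \<open>h j\<close> stands for the block computed from the mean at the start of the
  sweep, and \<open>v j\<close> for the one computed after the mean has drifted. The drift is made
  of earlier displacements \<open>v l - u l\<close>, so these control \<open>u - h\<close> as
  well.\<close>

lemma sweep_residual:
  fixes u v h :: "nat \<Rightarrow> 'a::real_inner"
  assumes "n \<ge> 1"
    and "\<And>j. j \<in> {1..n} \<Longrightarrow>
      norm (v j - h j) \<le> norm ((1 / real n) *\<^sub>R (\<Sum>l=1..<j. v l - u l))"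
  shows "(norm ((1 / real n) *\<^sub>R (\<Sum>l=1..n. u l - h l)))\<^sup>2
    \<le> 4 * (ln (real n) + 1) / (real n)\<^sup>2 * (\<Sum>l=1..n. real l * (norm (v l - u l))\<^sup>2)"
proof -
  define D where "D = (\<lambda>l. norm (v l - u l))"
  have bound: "norm (u j - h j) \<le> D j + (1 / real n) * (\<Sum>l=1..<j. D l)" if j: "j \<in> {1..n}" for j
  proof -
    have "norm (u j - h j) \<le> norm (v j - h j) + D j"
      using norm_triangle_ineq4[of "v j - h j" "v j - u j"] by (simp add: D_def)
    also have "norm (v j - h j) \<le> (1 / real n) * norm (\<Sum>l=1..<j. v l - u l)"
      using assms(2)[OF j] by simp
    also have "\<dots> \<le> (1 / real n) * (\<Sum>l=1..<j. D l)"
      unfolding D_def by (intro mult_left_mono norm_sum) simp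
    finally show ?thesis by simp
  qed
  have "norm (\<Sum>l=1..n. u l - h l) \<le> (\<Sum>j=1..n. norm (u j - h j))" by (rule norm_sum)
  also have "\<dots> \<le> (\<Sum>j=1..n. D j + (1 / real n) * (\<Sum>l=1..<j. D l))"
    by (rule sum_mono) (rule bound)
  also have "\<dots> = (\<Sum>j=1..n. D j) + (1 / real n) * (\<Sum>l=1..n. real (n - l) * D l)"
    unfolding sum.distrib sum_distrib_left[symmetric] sum_triangle_below by simp
  \<comment> \<open>Estimating \<open>n - l\<close> by \<open>n\<close> makes the drift cost at most
    one more copy of the sum of \<open>D\<close>; the resulting factor 2 becomes the 4 after
    squaring.\<close>
  also have "(\<Sum>l=1..n. real (n - l) * D l) \<le> (\<Sum>l=1..n. real n * D l)"
    by (intro sum_mono mult_right_mono) (auto simp: D_def)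
  also have "(\<Sum>j=1..n. D j) + (1 / real n) * (\<Sum>l=1..n. real n * D l) = 2 * (\<Sum>l=1..n. D l)"
    using assms(1) by (simp add: sum_distrib_left[symmetric])
  finally have 1: "norm (\<Sum>l=1..n. u l - h l) \<le> 2 * (\<Sum>l=1..n. D l)"
    by (simp add: divide_right_mono)
  \<comment> \<open>Splitting off \<open>1 / sqrt l\<close> makes Cauchy-Schwarz produce the
    harmonic sum and the weighted norm.\<close>
  have "(\<Sum>l=1..n. D l)\<^sup>2 = (\<Sum>l=1..n. (1 / sqrt (real l)) * (sqrt (real l) * D l))\<^sup>2"
    by (intro arg_cong[where f = "\<lambda>x. x\<^sup>2"] sum.cong) auto
  also have "\<dots> \<le> (\<Sum>l=1..n. (1 / sqrt (real l))\<^sup>2) * (\<Sum>l=1..n. (sqrt (real l) * D l)\<^sup>2)"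
    by (rule Cauchy_Schwarz_ineq_sum)
  also have "\<dots> = (\<Sum>l=1..n. 1 / real l) * (\<Sum>l=1..n. real l * (D l)\<^sup>2)"
    by (simp add: power_divide power_mult_distrib)
  also have "\<dots> \<le> (ln (real n) + 1) * (\<Sum>l=1..n. real l * (D l)\<^sup>2)"
    by (intro mult_right_mono sum_inverse_le_ln assms sum_nonneg) auto
  finally have 2: "(\<Sum>l=1..n. D l)\<^sup>2 \<le> (ln (real n) + 1) * (\<Sum>l=1..n. real l * (D l)\<^sup>2)" .
  have "(norm (\<Sum>l=1..n. u l - h l))\<^sup>2 \<le> (2 * (\<Sum>l=1..n. D l))\<^sup>2"
    by (intro power_mono 1) simp
  also have "\<dots> \<le> 4 * ((ln (real n) + 1) * (\<Sum>l=1..n. real l * (D l)\<^sup>2))"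
    using 2 by (simp add: power_mult_distrib)
  finally have "(norm (\<Sum>l=1..n. u l - h l))\<^sup>2 / (real n)\<^sup>2
      \<le> 4 * ((ln (real n) + 1) * (\<Sum>l=1..n. real l * (D l)\<^sup>2)) / (real n)\<^sup>2"
    by (rule divide_right_mono) simp
  moreover have "(norm ((1 / real n) *\<^sub>R (\<Sum>l=1..n. u l - h l)))\<^sup>2
      = (norm (\<Sum>l=1..n. u l - h l))\<^sup>2 / (real n)\<^sup>2"
    by (simp add: power_divide)
  ultimately show ?thesis unfolding D_def by (simp only: mult.assoc times_divide_eq_left)
qed

section \<open>The averaged iteration and its rate\<close>

lemma norm_sq_convex_combination:
  fixes a b :: "'a::real_inner"
  shows "(norm ((1 - \<theta>) *\<^sub>R a + \<theta> *\<^sub>R b))\<^sup>2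
    = (1 - \<theta>) * (norm a)\<^sup>2 + \<theta> * (norm b)\<^sup>2 - \<theta> * (1 - \<theta>) * (norm (b - a))\<^sup>2"
  unfolding power2_norm_eq_inner
  by (simp add: algebra_simps inner_commute)

text \<open>\<open>V k\<close> plays the image of \<open>U k\<close> under a nonexpansive map with
  fixed point \<open>c\<close>. The squared distance \<open>e\<close> to \<open>c\<close> drops by
  \<open>\<theta> * (1 - \<theta>) * d k\<close> per step, and the squared residual \<open>d\<close>
  never increases, so telescoping bounds \<open>k + 1\<close> copies of \<open>d k\<close> by
  \<open>e 0\<close>.\<close>

lemma krasnoselskii_mann_rate:
  fixes U V :: "nat \<Rightarrow> 'i \<Rightarrow> 'a::real_inner" and w :: "'i \<Rightarrow> real"
  assumes \<theta>: "0 < \<theta>" "\<theta> < 1"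
    and w: "\<And>l. l \<in> I \<Longrightarrow> 0 \<le> w l"
    and upd: "\<And>k l. l \<in> I \<Longrightarrow> U (Suc k) l = (1 - \<theta>) *\<^sub>R U k l + \<theta> *\<^sub>R V k l"
    and fixed: "\<And>k. (\<Sum>l\<in>I. w l * (norm (V k l - c l))\<^sup>2) \<le> (\<Sum>l\<in>I. w l * (norm (U k l - c l))\<^sup>2)"
    and nonexp: "\<And>k. (\<Sum>l\<in>I. w l * (norm (V (Suc k) l - V k l))\<^sup>2)
      \<le> (\<Sum>l\<in>I. w l * (norm (U (Suc k) l - U k l))\<^sup>2)"
  shows "(\<Sum>l\<in>I. w l * (norm (V k l - U k l))\<^sup>2)
    \<le> (\<Sum>l\<in>I. w l * (norm (U 0 l - c l))\<^sup>2) / ((real k + 1) * \<theta> * (1 - \<theta>))"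
proof -
  define N where "N = (\<lambda>a :: 'i \<Rightarrow> 'a. \<Sum>l\<in>I. w l * (norm (a l))\<^sup>2)"
  have N_nonneg: "0 \<le> N a" for a unfolding N_def by (intro sum_nonneg) (simp add: w)
  have N_comb: "N (\<lambda>l. (1 - \<theta>) *\<^sub>R a l + \<theta> *\<^sub>R b l)
      = (1 - \<theta>) * N a + \<theta> * N b - \<theta> * (1 - \<theta>) * N (\<lambda>l. b l - a l)" for a b
    unfolding N_def norm_sq_convex_combination
    by (simp add: algebra_simps sum.distrib sum_subtractf sum_distrib_left)
  have N_scale: "N (\<lambda>l. s *\<^sub>R a l) = s\<^sup>2 * N a" for s a
    unfolding N_def by (simp add: sum_distrib_left power_mult_distrib algebra_simps)
  have N_cong: "N a = N b" if "\<And>l. l \<in> I \<Longrightarrow> a l = b l" for a b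
    unfolding N_def using that by (intro sum.cong) auto
  define e where "e = (\<lambda>k. N (\<lambda>l. U k l - c l))"
  define d where "d = (\<lambda>k. N (\<lambda>l. V k l - U k l))"
  have descent: "e (Suc k) \<le> e k - \<theta> * (1 - \<theta>) * d k" for k
  proof -
    have "e (Suc k) = N (\<lambda>l. (1 - \<theta>) *\<^sub>R (U k l - c l) + \<theta> *\<^sub>R (V k l - c l))"
      unfolding e_def by (rule N_cong) (simp add: upd algebra_simps)
    also have "\<dots> = (1 - \<theta>) * e k + \<theta> * N (\<lambda>l. V k l - c l) - \<theta> * (1 - \<theta>) * d k"
      unfolding N_comb by (simp add: e_def d_def)
    also have "N (\<lambda>l. V k l - c l) \<le> e k" using fixed[of k] by (simp add: N_def e_def)
    finally show ?thesis using \<theta> by (simp add: algebra_simps)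
  qed
  have d_mono: "d (Suc k) \<le> d k" for k
  proof -
    define A where "A = (\<lambda>l. V (Suc k) l - V k l)"
    have "N A \<le> N (\<lambda>l. U (Suc k) l - U k l)" using nonexp[of k] by (simp add: N_def A_def)
    also have "\<dots> = N (\<lambda>l. \<theta> *\<^sub>R (V k l - U k l))"
      by (rule N_cong) (simp add: upd algebra_simps)
    finally have "N A \<le> \<theta>\<^sup>2 * d k" by (simp add: N_scale d_def)
    then have A: "(1 / \<theta>)\<^sup>2 * N A \<le> d k" using \<theta> by (simp add: field_simps)
    \<comment> \<open>The new residual is \<open>(1 - \<theta>)\<close> times the old one plus
      \<open>A\<close>. Writing \<open>A\<close> as \<open>\<theta>\<close> times
      \<open>A / \<theta>\<close> makes this a convex combination of two vectors whose squared norms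
      are at most \<open>d k\<close>.\<close>
    have "d (Suc k) = N (\<lambda>l. (1 - \<theta>) *\<^sub>R (V k l - U k l) + \<theta> *\<^sub>R ((1 / \<theta>) *\<^sub>R A l))"
      unfolding d_def by (rule N_cong) (use \<theta> in \<open>simp add: upd A_def algebra_simps\<close>)
    also have "\<dots> \<le> (1 - \<theta>) * d k + \<theta> * ((1 / \<theta>)\<^sup>2 * N A)"
      unfolding N_comb N_scale using \<theta> N_nonneg by (simp add: d_def)
    also have "\<dots> \<le> (1 - \<theta>) * d k + \<theta> * d k"
      by (intro add_left_mono mult_left_mono A) (use \<theta> in simp)
    finally show ?thesis by (simp add: algebra_simps)
  qed
  have telescope: "\<theta> * (1 - \<theta>) * (\<Sum>j\<le>k. d j) + e (Suc k) \<le> e 0" for k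
  proof (induction k)
    case 0
    then show ?case using descent[of 0] by simp
  next
    case (Suc k)
    then show ?case using descent[of "Suc k"] by (simp add: algebra_simps)
  qed
  have "(real k + 1) * d k \<le> (\<Sum>j\<le>k. d j)"
  proof -
    have "(\<Sum>j\<le>k. d k) \<le> (\<Sum>j\<le>k. d j)"
      by (rule sum_mono, rule lift_Suc_antimono_le[of d, OF d_mono]) simp
    then show ?thesis by (simp add: add.commute)
  qed
  then have "\<theta> * (1 - \<theta>) * ((real k + 1) * d k) \<le> \<theta> * (1 - \<theta>) * (\<Sum>j\<le>k. d j)"
    using \<theta> by (intro mult_left_mono) auto
  also have "\<dots> \<le> e 0"
    using telescope[of k] N_nonneg[of "\<lambda>l. U (Suc k) l - c l"] by (simp add: e_def)
  finally have "\<theta> * (1 - \<theta>) * ((real k + 1) * d k) \<le> e 0" .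
  then have "d k \<le> e 0 / ((real k + 1) * \<theta> * (1 - \<theta>))"
    using \<theta> by (subst pos_le_divide_eq) (auto simp: mult_ac intro!: mult_pos_pos)
  then show ?thesis by (simp add: d_def e_def N_def)
qed

section \<open>Averages over uniformly random permutations\<close>

lemma sum_permutations_apply:
  fixes b :: "nat \<Rightarrow> real"
  assumes j: "j \<in> {1..n}"
  shows "(\<Sum>p | p permutes {1..n}. b (p j)) = fact n / real n * (\<Sum>i=1..n. b i)"
proof -
  define P where "P = {p. p permutes {1..n}}"
  \<comment> \<open>Composing with the transposition of \<open>i\<close> and \<open>j\<close> is an
    involution on the permutations, so the position is immaterial and the sum may be averaged over
    all positions.\<close>
  have indep: "(\<Sum>p\<in>P. b (p i)) = (\<Sum>p\<in>P. b (p j))" if i: "i \<in> {1..n}" for i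
  proof -
    have t: "Transposition.transpose i j permutes {1..n}" using i j by (rule permutes_swap_id)
    show ?thesis
      by (rule sum.reindex_bij_witness[of _ "\<lambda>p. p \<circ> Transposition.transpose i j" "\<lambda>p. p \<circ> Transposition.transpose i j"])
        (auto simp: P_def fun_eq_iff intro!: permutes_compose[OF t[simplified]])
  qed
  have "real n * (\<Sum>p\<in>P. b (p j)) = (\<Sum>i=1..n. \<Sum>p\<in>P. b (p i))" by (simp add: indep)
  also have "\<dots> = (\<Sum>p\<in>P. \<Sum>i=1..n. b (p i))" by (rule sum.swap)
  also have "\<dots> = (\<Sum>p\<in>P. \<Sum>i=1..n. b i)"
    by (rule sum.cong) (auto simp: P_def sum.permute[of _ _ b] o_def)
  also have "\<dots> = fact n * (\<Sum>i=1..n. b i)"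
    using card_permutations[of "{1..n}" n] by (simp add: P_def)
  finally show ?thesis using j by (simp add: P_def field_simps)
qed

lemma expectation_permutation_weighted:
  fixes b :: "nat \<Rightarrow> real"
  assumes "n \<ge> 1"
  shows "measure_pmf.expectation (pmf_of_set {p. p permutes {1..n}}) (\<lambda>p. \<Sum>l=1..n. real l * b (p l))
    = (real n + 1) / 2 * (\<Sum>i=1..n. b i)"
proof -
  let ?P = "{p. p permutes {1..n}}"
  have P: "?P \<noteq> {}" "finite ?P" "real (card ?P) = fact n"
    using permutes_id[of "{Suc 0..n}"] card_permutations[of "{1..n}" n] finite_permutations[of "{1..n}"] by (auto intro: exI[of _ id])
  have "(\<Sum>p\<in>?P. \<Sum>l=1..n. real l * b (p l)) = (\<Sum>l=1..n. real l * (\<Sum>p\<in>?P. b (p l)))"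
    by (subst sum.swap) (simp add: sum_distrib_left)
  also have "\<dots> = (\<Sum>l=1..n. real l) * (fact n / real n * (\<Sum>i=1..n. b i))"
    unfolding sum_distrib_right
    by (intro sum.cong refl arg_cong2[where f = "(*)"] sum_permutations_apply)
  also have "(\<Sum>l=1..n. real l) = real n * (real n + 1) / 2"
    using double_gauss_sum_from_Suc_0[of n, where 'a=real] by simp
  finally show ?thesis
    using P assms by (simp add: integral_pmf_of_set)
qed

subsection \<open>Prox-DFinito\<close>

text \<open>This is the map \<open>G\<^sub>i\<close>. The block written by a step depends on the
  state only through the running mean.\<close>

definition dfinito_block ::
  "(nat \<Rightarrow> 'a::real_inner \<Rightarrow> real) \<Rightarrow> ('a \<Rightarrow> ereal) \<Rightarrow> real \<Rightarrow> nat \<Rightarrow> 'a \<Rightarrow> 'a" where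
  "dfinito_block f r \<alpha> i y = prox \<alpha> r y - \<alpha> *\<^sub>R grad (f i) (prox \<alpha> r y)"

text \<open>A relation between the blocks before and after an epoch, in Gauss-Seidel form. Indices
  are positions in the visiting order; the permutation is hidden in \<open>H\<close>.\<close>

definition is_sweep :: "nat \<Rightarrow> (nat \<Rightarrow> 'a::real_vector \<Rightarrow> 'a) \<Rightarrow> (nat \<Rightarrow> 'a) \<Rightarrow> (nat \<Rightarrow> 'a) \<Rightarrow> bool" where
  "is_sweep n H u v \<longleftrightarrow>
     (\<forall>j\<in>{1..n}. v j = H j ((1 / real n) *\<^sub>R ((\<Sum>l=1..<j. v l) + (\<Sum>l=j..n. u l))))"

lemma is_sweep_nonexpansive:
  fixes u v :: "nat \<Rightarrow> 'a::real_inner"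
  assumes H: "\<And>j x y. j \<in> {1..n} \<Longrightarrow> norm (H j x - H j y) \<le> norm (x - y)"
    and "is_sweep n H u v" "is_sweep n H u' v'"
  shows "(\<Sum>l=1..n. real l * (norm (v l - v' l))\<^sup>2) \<le> (\<Sum>l=1..n. real l * (norm (u l - u' l))\<^sup>2)"
proof (rule sweep_nonexpansive)
  fix j assume j: "j \<in> {1..n}"
  define y y' where "y = (1 / real n) *\<^sub>R ((\<Sum>l=1..<j. v l) + (\<Sum>l=j..n. u l))"
    and "y' = (1 / real n) *\<^sub>R ((\<Sum>l=1..<j. v' l) + (\<Sum>l=j..n. u' l))"
  have "norm (v j - v' j) \<le> norm (y - y')"
    using H[OF j, of y y'] assms(2,3) j by (simp add: is_sweep_def y_def y'_def)
  also have "y - y' = (1 / real n) *\<^sub>R ((\<Sum>l=1..<j. v l - v' l) + (\<Sum>l=j..n. u l - u' l))"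
    unfolding y_def y'_def scaleR_diff_right[symmetric] by (simp add: sum_subtractf)
  finally show "norm (v j - v' j)
    \<le> norm ((1 / real n) *\<^sub>R ((\<Sum>l=1..<j. v l - v' l) + (\<Sum>l=j..n. u l - u' l)))" .
qed

lemma is_sweep_residual:
  fixes u v :: "nat \<Rightarrow> 'a::real_inner"
  assumes n: "n \<ge> 1"
    and H: "\<And>j x y. j \<in> {1..n} \<Longrightarrow> norm (H j x - H j y) \<le> norm (x - y)"
    and sweep: "is_sweep n H u v"
    and y: "y = (1 / real n) *\<^sub>R (\<Sum>l=1..n. u l)"
  shows "(norm (y - (1 / real n) *\<^sub>R (\<Sum>l=1..n. H l y)))\<^sup>2
    \<le> 4 * (ln (real n) + 1) / (real n)\<^sup>2 * (\<Sum>l=1..n. real l * (norm (v l - u l))\<^sup>2)"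
proof -
  have "norm (v j - H j y) \<le> norm ((1 / real n) *\<^sub>R (\<Sum>l=1..<j. v l - u l))" if j: "j \<in> {1..n}" for j
  proof -
    define w where "w = (1 / real n) *\<^sub>R ((\<Sum>l=1..<j. v l) + (\<Sum>l=j..n. u l))"
    have "norm (v j - H j y) \<le> norm (w - y)"
      using H[OF j, of w y] sweep j by (simp add: is_sweep_def w_def)
    also have "w - y = (1 / real n) *\<^sub>R (\<Sum>l=1..<j. v l - u l)"
      unfolding w_def y scaleR_diff_right[symmetric] sum_split_at[OF j] by (simp add: sum_subtractf)
    finally show ?thesis .
  qed
  from sweep_residual[OF n this]
  show ?thesis by (simp add: y sum_subtractf scaleR_diff_right)
qed

text \<open>Since \<open>q\<close> is injective, a block is untouched until its own step. The
  incremental update of the average therefore subtracts exactly the old block, and the average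
  remains the true mean throughout.\<close>

lemma dfinito_inner_sweep:
  fixes f :: "nat \<Rightarrow> 'a::real_inner \<Rightarrow> real"
    and r :: "'a \<Rightarrow> ereal" and \<alpha> :: real and s :: "'a dfinito_state"
    and q \<iota> :: "nat \<Rightarrow> nat" and k :: nat
  assumes inj: "inj_on q {1..n}"
    and \<iota>: "\<And>j. j \<in> {1..n} \<Longrightarrow> \<iota> (k * n + j) = q j"
    and mean: "snd s = (1 / real n) *\<^sub>R (\<Sum>l=1..n. fst s (q l))"
  defines "S \<equiv> dfinito_inner n f r \<alpha> \<iota> k s"
  shows "is_sweep n (\<lambda>l. dfinito_block f r \<alpha> (q l)) (\<lambda>l. fst s (q l)) (\<lambda>l. fst (S n) (q l))"
    and "snd (S n) = (1 / real n) *\<^sub>R (\<Sum>l=1..n. fst (S n) (q l))"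
proof -
  \<comment> \<open>\<open>w l\<close> is the value written at step \<open>l\<close>.\<close>
  define u w where "u = (\<lambda>l. fst s (q l))" and "w = (\<lambda>l. fst (S l) (q l))"
  have step: "S (Suc m) = ((fst (S m))(q (Suc m) := w (Suc m)),
      snd (S m) + (1 / real n) *\<^sub>R (w (Suc m) - fst (S m) (q (Suc m))))"
    and w: "w (Suc m) = dfinito_block f r \<alpha> (q (Suc m)) (snd (S m))" if "m < n" for m
    using \<iota>[of "Suc m"] that
    by (auto simp: w_def S_def dfinito_step_def dfinito_block_def Let_def case_prod_unfold)
  have inv: "(\<forall>l\<in>{1..n}. fst (S m) (q l) = (if l \<le> m then w l else u l)) \<and>
      snd (S m) = (1 / real n) *\<^sub>R ((\<Sum>l=1..<Suc m. w l) + (\<Sum>l=Suc m..n. u l))" if "m \<le> n" for m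
    using that
  proof (induction m)
    case 0
    then show ?case using mean by (simp add: S_def u_def)
  next
    case (Suc m)
    then have IH: "\<And>l. l \<in> {1..n} \<Longrightarrow> fst (S m) (q l) = (if l \<le> m then w l else u l)"
      "snd (S m) = (1 / real n) *\<^sub>R ((\<Sum>l=1..<Suc m. w l) + (\<Sum>l=Suc m..n. u l))" by auto
    have "fst (S (Suc m)) (q l) = (if l \<le> Suc m then w l else u l)" if l: "l \<in> {1..n}" for l
    proof (cases "l = Suc m")
      case False
      then have "q l \<noteq> q (Suc m)" using inj l Suc.prems by (auto dest: inj_onD)
      then show ?thesis using IH(1)[OF l] False Suc.prems by (auto simp: step)
    qed (use Suc.prems in \<open>simp add: step\<close>)
    moreover have "snd (S (Suc m)) = snd (S m) + (1 / real n) *\<^sub>R (w (Suc m) - u (Suc m))"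
      using IH(1)[of "Suc m"] Suc.prems by (simp add: step)
    moreover have "(\<Sum>l=Suc m..n. u l) = u (Suc m) + (\<Sum>l=Suc (Suc m)..n. u l)"
      using Suc.prems by (rule sum.atLeast_Suc_atMost)
    ultimately show ?case
      unfolding IH(2) scaleR_add_right[symmetric] by simp
  qed
  have v: "fst (S n) (q l) = w l" if "l \<in> {1..n}" for l
    using inv[of n] that by auto
  show "is_sweep n (\<lambda>l. dfinito_block f r \<alpha> (q l)) (\<lambda>l. fst s (q l)) (\<lambda>l. fst (S n) (q l))"
    unfolding is_sweep_def
  proof
    fix j assume j: "j \<in> {1..n}"
    then obtain m where m: "j = Suc m" "m < n" by (cases j) auto
    have "(\<Sum>l=1..<j. fst (S n) (q l)) = (\<Sum>l=1..<j. w l)"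
      using j by (intro sum.cong refl v) auto
    then show "fst (S n) (q j) = dfinito_block f r \<alpha> (q j)
        ((1 / real n) *\<^sub>R ((\<Sum>l=1..<j. fst (S n) (q l)) + (\<Sum>l=j..n. fst s (q l))))"
      using v[OF j] w[OF m(2)] inv[of m] m by (simp add: u_def)
  qed
  have "(\<Sum>l=1..n. fst (S n) (q l)) = (\<Sum>l=1..n. w l)" by (intro sum.cong refl v)
  then show "snd (S n) = (1 / real n) *\<^sub>R (\<Sum>l=1..n. fst (S n) (q l))"
    using inv[of n] by (simp add: atLeastLessThanSuc_atLeastAtMost)
qed

lemma cyclic_order_apply:
  assumes "j \<in> {1..n}"
  shows "cyclic_order n p (k * n + j) = p j"
proof -
  have "(k * n + j - 1) mod n = j - 1"
    using assms by (metis Nat.add_diff_assoc atLeastAtMost_iff diff_Suc_less mod_less mod_mult_self3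
        less_le_trans not_gr_zero not_one_le_zero One_nat_def)
  then show ?thesis using assms by (simp add: cyclic_order_def)
qed

text \<open>An epoch keeps the stored average equal to the mean of the blocks, and damping acts on
  both by the same convex combination. The sum runs in visiting order to match the sweep.\<close>

lemma dfinito_epoch_mean:
  fixes f :: "nat \<Rightarrow> 'a::real_inner \<Rightarrow> real"
    and r :: "'a \<Rightarrow> ereal" and \<alpha> :: real and \<theta> :: real and z0 :: "nat \<Rightarrow> 'a"
  assumes p: "p permutes {1..n}"
  defines "S \<equiv> dfinito_epoch n f r \<alpha> \<theta> (cyclic_order n p) z0"
  shows "snd (S k) = (1 / real n) *\<^sub>R (\<Sum>l=1..n. fst (S k) (p l))"
proof (induction k)
  case 0
  show ?case
    using sum.permute[OF p, of z0] by (simp add: S_def dfinito_init_def o_def)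
next
  case (Suc k)
  define T where "T = dfinito_inner n f r \<alpha> (cyclic_order n p) k (S k) n"
  have "snd T = (1 / real n) *\<^sub>R (\<Sum>l=1..n. fst T (p l))"
    unfolding T_def
    by (rule dfinito_inner_sweep(2)[OF permutes_inj_on[OF p] cyclic_order_apply Suc])
  moreover have "S (Suc k) = dfinito_damp \<theta> (S k) T" by (simp add: S_def T_def Let_def)
  moreover have "(\<Sum>l=1..n. (1 - \<theta>) *\<^sub>R fst (S k) (p l) + \<theta> *\<^sub>R fst T (p l))
      = (1 - \<theta>) *\<^sub>R (\<Sum>l=1..n. fst (S k) (p l)) + \<theta> *\<^sub>R (\<Sum>l=1..n. fst T (p l))"
    by (simp only: sum.distrib scaleR_sum_right)
  ultimately show ?case
    using Suc by (simp add: dfinito_damp_def case_prod_unfold scaleR_add_right mult.commute)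
qed

lemma dfinito_residual_rate:
  fixes z0 c :: "nat \<Rightarrow> 'a::real_inner"
  assumes n: "n \<ge> 1" and p: "p permutes {1..n}"
    and \<theta>: "0 < \<theta>" "\<theta> < 1"
    and nonexp: "\<And>i x y. i \<in> {1..n} \<Longrightarrow>
      norm (dfinito_block f r \<alpha> i x - dfinito_block f r \<alpha> i y) \<le> norm (x - y)"
    and fixed: "\<And>i. i \<in> {1..n} \<Longrightarrow>
      dfinito_block f r \<alpha> i ((1 / real n) *\<^sub>R (\<Sum>i=1..n. c i)) = c i"
    and y: "y = snd (dfinito_epoch n f r \<alpha> \<theta> (cyclic_order n p) z0 k)"
  shows "(norm (y - (1 / real n) *\<^sub>R (\<Sum>i=1..n. dfinito_block f r \<alpha> i y)))\<^sup>2
    \<le> 4 * (ln (real n) + 1) / (real n)\<^sup>2 *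
      ((\<Sum>l=1..n. real l * (norm (z0 (p l) - c (p l)))\<^sup>2) / ((real k + 1) * \<theta> * (1 - \<theta>)))"
proof -
  define S where "S = dfinito_epoch n f r \<alpha> \<theta> (cyclic_order n p) z0"
  define U where "U = (\<lambda>k l. fst (S k) (p l))"
  define V where "V = (\<lambda>k l. fst (dfinito_inner n f r \<alpha> (cyclic_order n p) k (S k) n) (p l))"
  define H where "H = (\<lambda>l. dfinito_block f r \<alpha> (p l))"
  have mean: "snd (S k) = (1 / real n) *\<^sub>R (\<Sum>l=1..n. U k l)" for k
    unfolding U_def S_def by (rule dfinito_epoch_mean[OF p])
  have H: "norm (H j x - H j y) \<le> norm (x - y)" if "j \<in> {1..n}" for j x y
    unfolding H_def using that permutes_in_image[OF p] by (intro nonexp) blast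
  have sweep: "is_sweep n H (U k) (V k)" for k
    unfolding H_def U_def V_def
    by (rule dfinito_inner_sweep(1)[OF permutes_inj_on[OF p] cyclic_order_apply mean[unfolded U_def]])
  \<comment> \<open>The fixed point is a sweep from itself to itself, so the distance to it is
    covered by the nonexpansiveness of sweeps.\<close>
  have fixed_sweep: "is_sweep n H (\<lambda>l. c (p l)) (\<lambda>l. c (p l))"
    unfolding is_sweep_def
  proof
    fix j assume j: "j \<in> {1..n}"
    have "(\<Sum>l=1..<j. c (p l)) + (\<Sum>l=j..n. c (p l)) = (\<Sum>i=1..n. c i)"
      using sum.permute[OF p, of c] sum_split_at[OF j, of "\<lambda>l. c (p l)"] by (simp add: o_def)
    then show "c (p j) = H j ((1 / real n) *\<^sub>R ((\<Sum>l=1..<j. c (p l)) + (\<Sum>l=j..n. c (p l))))"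
      using fixed[of "p j"] permutes_in_image[OF p, of j] j by (simp add: H_def)
  qed
  have "(norm (y - (1 / real n) *\<^sub>R (\<Sum>l=1..n. H l y)))\<^sup>2
      \<le> 4 * (ln (real n) + 1) / (real n)\<^sup>2 * (\<Sum>l=1..n. real l * (norm (V k l - U k l))\<^sup>2)"
    by (rule is_sweep_residual[OF n H sweep]) (simp_all add: y mean[unfolded S_def])
  also have "(\<Sum>l=1..n. real l * (norm (V k l - U k l))\<^sup>2)
      \<le> (\<Sum>l=1..n. real l * (norm (U 0 l - c (p l)))\<^sup>2) / ((real k + 1) * \<theta> * (1 - \<theta>))"
  proof (rule krasnoselskii_mann_rate[OF \<theta>])
    show "U (Suc k) l = (1 - \<theta>) *\<^sub>R U k l + \<theta> *\<^sub>R V k l" for k l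
      by (simp add: U_def V_def S_def Let_def dfinito_damp_def case_prod_unfold)
    show "(\<Sum>l=1..n. real l * (norm (V k l - c (p l)))\<^sup>2)
        \<le> (\<Sum>l=1..n. real l * (norm (U k l - c (p l)))\<^sup>2)" for k
      by (rule is_sweep_nonexpansive[OF H sweep fixed_sweep])
    show "(\<Sum>l=1..n. real l * (norm (V (Suc k) l - V k l))\<^sup>2)
        \<le> (\<Sum>l=1..n. real l * (norm (U (Suc k) l - U k l))\<^sup>2)" for k
      by (rule is_sweep_nonexpansive[OF H sweep sweep])
  qed simp
  also have "U 0 = (\<lambda>l. z0 (p l))" by (simp add: U_def S_def dfinito_init_def)
  also have "(\<Sum>l=1..n. H l y) = (\<Sum>i=1..n. dfinito_block f r \<alpha> i y)"
    using sum.permute[OF p, of "\<lambda>i. dfinito_block f r \<alpha> i y"] by (simp add: H_def o_def)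
  finally show ?thesis using n by (simp add: mult_left_mono divide_right_mono)
qed

section \<open>From the fixed-point residual to the subgradient bound\<close>

lemma GDERIV_finite_sum_obj:
  assumes "\<And>i. i \<in> {1..n} \<Longrightarrow> GDERIV (f i) x :> D i"
  shows "GDERIV (finite_sum_obj n f) x :> (1 / real n) *\<^sub>R (\<Sum>i=1..n. D i)"
  using assms unfolding gderiv_def finite_sum_obj_def[abs_def]
  by (auto intro!: derivative_eq_intros simp: inner_sum_right divide_inverse mult.commute)

text \<open>The mean of the blocks computed from \<open>y\<close> is a gradient step on the full sum
  \<open>F\<close> from the proximal point \<open>x\<close>, so the residual divided by
  \<open>\<alpha>\<close> is \<open>grad F x\<close> plus the proximal subgradient at
  \<open>x\<close>.\<close>

lemma min_subgrad_sq_prox_le: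
  fixes y :: "'a::euclidean_space"
  assumes "n \<ge> 1" "0 < \<alpha>"
    and smooth: "\<And>i. i \<in> {1..n} \<Longrightarrow> f i differentiable at (prox \<alpha> r y)"
    and prox: "(1 / \<alpha>) *\<^sub>R (y - prox \<alpha> r y) \<in> subdifferential r (prox \<alpha> r y)"
      "\<bar>r (prox \<alpha> r y)\<bar> \<noteq> \<infinity>"
  shows "min_subgrad_sq (finite_sum_obj n f) r (prox \<alpha> r y)
    \<le> (norm (y - (1 / real n) *\<^sub>R (\<Sum>i=1..n. dfinito_block f r \<alpha> i y)))\<^sup>2 / \<alpha>\<^sup>2"
proof -
  define x where "x = prox \<alpha> r y"
  have G: "grad (finite_sum_obj n f) x = (1 / real n) *\<^sub>R (\<Sum>i=1..n. grad (f i) x)"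
    unfolding x_def by (intro grad_eqI GDERIV_finite_sum_obj GDERIV_grad smooth)
  have "(1 / real n) *\<^sub>R (\<Sum>i=1..n. dfinito_block f r \<alpha> i y) = x - \<alpha> *\<^sub>R grad (finite_sum_obj n f) x"
    using assms(1)
    by (simp add: dfinito_block_def x_def[symmetric] G sum_subtractf scaleR_diff_right
        scaleR_sum_right[symmetric] sum_constant_scaleR mult.commute)
  then have "grad (finite_sum_obj n f) x + (1 / \<alpha>) *\<^sub>R (y - x)
      = (1 / \<alpha>) *\<^sub>R (y - (1 / real n) *\<^sub>R (\<Sum>i=1..n. dfinito_block f r \<alpha> i y))"
    using assms(2) by (simp only:) (simp add: scaleR_diff_right)
  then have "(norm (grad (finite_sum_obj n f) x + (1 / \<alpha>) *\<^sub>R (y - x)))\<^sup>2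
      = (norm (y - (1 / real n) *\<^sub>R (\<Sum>i=1..n. dfinito_block f r \<alpha> i y)))\<^sup>2 / \<alpha>\<^sup>2"
    by (simp add: power_divide)
  then show ?thesis
    using min_subgrad_sq_le[OF prox, of "finite_sum_obj n f"] by (simp add: x_def)
qed

theorem mainTheorem4:
  fixes f :: "nat \<Rightarrow> real ^ 'd \<Rightarrow> real"
    and r :: "real ^ 'd \<Rightarrow> ereal"
    and z0 zstar :: "nat \<Rightarrow> real ^ 'd"
    and xstar :: "real ^ 'd"
    and L \<alpha> \<theta> C :: real
    and n :: nat
  defines "C \<equiv> (2 / (\<alpha> * L))\<^sup>2 * ((real n + 1) * (ln (real n) + 1) / (2 * (real n)\<^sup>2))
                 * (L2_set (\<lambda>i. norm (z0 i - zstar i)) {1..n})\<^sup>2"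
  assumes "n \<ge> 1"
    and "L > 0"
    and "\<And>i. i \<in> {1..n} \<Longrightarrow> convex_on UNIV (f i)"
    and "\<And>i. i \<in> {1..n} \<Longrightarrow> smooth_fun L (f i)"
    and "convex_fun r" and "closed_fun r" and "proper_fun r"
    and "is_arg_min (\<lambda>x. ereal (finite_sum_obj n f x) + r x) (\<lambda>_. True) xstar"
    and "\<And>i. i \<in> {1..n} \<Longrightarrow> zstar i = xstar - \<alpha> *\<^sub>R grad (f i) xstar"
    and "0 < \<alpha>" and "\<alpha> \<le> 2 / L"
    and "0 < \<theta>" and "\<theta> < 1"
  shows "\<forall>k. measure_pmf.expectation (pmf_of_set {p. p permutes {1..n}})
           (\<lambda>p. min_subgrad_sq (finite_sum_obj n f) r
                  (dfinito_x n f r \<alpha> \<theta> (cyclic_order n p) z0 (k * n)))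
         \<le> C * L\<^sup>2 / ((real k + 1) * \<theta> * (1 - \<theta>))"
proof
  fix k
  note n = \<open>n \<ge> 1\<close> and \<alpha> = \<open>0 < \<alpha>\<close> and \<theta> = \<open>0 < \<theta>\<close> \<open>\<theta> < 1\<close>
  note r = \<open>convex_fun r\<close> \<open>closed_fun r\<close> \<open>proper_fun r\<close>
  have diff: "f i differentiable at x" if "i \<in> {1..n}" for i x
    using assms(5)[OF that] by (simp add: smooth_fun_def)
  define D where "D = (1 / real n) *\<^sub>R (\<Sum>i=1..n. grad (f i) xstar)"
  have "GDERIV (finite_sum_obj n f) xstar :> D"
    unfolding D_def by (intro GDERIV_finite_sum_obj GDERIV_grad diff)
  then have opt: "- D \<in> subdifferential r xstar" "\<bar>r xstar\<bar> \<noteq> \<infinity>"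
    using assms(9) subdifferential_minimizer[OF r(1,3)]
    by (auto simp: is_arg_min_def not_less)
  \<comment> \<open>Optimality of \<open>xstar\<close> provides the affine minorant that existence
    of proximal points rests on.\<close>
  note prox = prox_subgradient[OF r \<alpha> opt]
  have nonexp: "norm (dfinito_block f r \<alpha> i x - dfinito_block f r \<alpha> i y) \<le> norm (x - y)"
    if "i \<in> {1..n}" for i x y
    unfolding dfinito_block_def
    by (rule order_trans[OF gradient_step_nonexpansive resolvent_nonexpansive[OF prox prox \<alpha>]])
      (use that assms in auto)
  define ybar where "ybar = (1 / real n) *\<^sub>R (\<Sum>i=1..n. zstar i)"
  have "ybar = xstar - \<alpha> *\<^sub>R D"
    using n by (simp add: ybar_def assms(10) D_def sum_subtractf scaleR_diff_right
        scaleR_sum_right[symmetric] sum_constant_scaleR del: sum_constant)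
  then have "(1 / \<alpha>) *\<^sub>R (ybar - xstar) \<in> subdifferential r xstar"
    using opt(1) \<alpha> by simp
  \<comment> \<open>Both points are resolvents of the same \<open>ybar\<close>, so
    \<open>prox \<alpha> r ybar = xstar\<close>.\<close>
  from resolvent_nonexpansive[OF prox[of ybar] this opt(2) \<alpha>]
  have fixed: "dfinito_block f r \<alpha> i ybar = zstar i" if "i \<in> {1..n}" for i
    using assms(10)[OF that] by (simp add: dfinito_block_def)
  define c where "c = 4 * (ln (real n) + 1) / (real n)\<^sup>2 / ((real k + 1) * \<theta> * (1 - \<theta>)) / \<alpha>\<^sup>2"
  define b where "b = (\<lambda>i. (norm (z0 i - zstar i))\<^sup>2)"
  have bound: "min_subgrad_sq (finite_sum_obj n f) r
      (dfinito_x n f r \<alpha> \<theta> (cyclic_order n p) z0 (k * n)) \<le> c * (\<Sum>l=1..n. real l * b (p l))"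
    if p: "p permutes {1..n}" for p
  proof -
    define y where "y = snd (dfinito_epoch n f r \<alpha> \<theta> (cyclic_order n p) z0 k)"
    \<comment> \<open>At time \<open>k * n\<close> the inner loop of epoch \<open>k\<close> has made
      no step yet.\<close>
    have "dfinito_x n f r \<alpha> \<theta> (cyclic_order n p) z0 (k * n) = prox \<alpha> r y"
      using n by (simp add: dfinito_x_def y_def)
    moreover have "min_subgrad_sq (finite_sum_obj n f) r (prox \<alpha> r y)
      \<le> (norm (y - (1 / real n) *\<^sub>R (\<Sum>i=1..n. dfinito_block f r \<alpha> i y)))\<^sup>2 / \<alpha>\<^sup>2"
      by (rule min_subgrad_sq_prox_le[OF n \<alpha> diff prox])
    moreover have "\<dots> \<le> 4 * (ln (real n) + 1) / (real n)\<^sup>2 *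
      ((\<Sum>l=1..n. real l * b (p l)) / ((real k + 1) * \<theta> * (1 - \<theta>))) / \<alpha>\<^sup>2"
      unfolding b_def
      by (intro divide_right_mono dfinito_residual_rate[OF n p \<theta> nonexp fixed[unfolded ybar_def] y_def])
        auto
    ultimately show ?thesis by (simp add: c_def)
  qed
  let ?P = "{p. p permutes {1..n}}"
  have "?P \<noteq> {}" using permutes_id[of "{1..n}"] by blast
  moreover have "finite ?P" by (rule finite_permutations) simp
  ultimately have P: "finite ?P" "set_pmf (pmf_of_set ?P) = ?P"
    by simp_all
  have "measure_pmf.expectation (pmf_of_set ?P)
      (\<lambda>p. min_subgrad_sq (finite_sum_obj n f) r (dfinito_x n f r \<alpha> \<theta> (cyclic_order n p) z0 (k * n)))
    \<le> measure_pmf.expectation (pmf_of_set ?P) (\<lambda>p. c * (\<Sum>l=1..n. real l * b (p l)))"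
    by (intro integral_mono_AE integrable_measure_pmf_finite AE_pmfI) (use P bound in simp_all)
  also have "\<dots> = c * ((real n + 1) / 2 * (\<Sum>i=1..n. b i))"
    using expectation_permutation_weighted[OF n, of b] by simp
  also have "(\<Sum>i=1..n. b i) = (L2_set (\<lambda>i. norm (z0 i - zstar i)) {1..n})\<^sup>2"
    by (simp add: L2_set_def b_def sum_nonneg)
  also have "c * ((real n + 1) / 2 * \<dots>) = C * L\<^sup>2 / ((real k + 1) * \<theta> * (1 - \<theta>))"
  proof -
    \<comment> \<open>The \<open>4 / \<alpha>\<^sup>2\<close> in \<open>c\<close> equals
      \<open>(2 / (\<alpha> * L))\<^sup>2 * L\<^sup>2\<close>.\<close>
    have "4 * l / m / K / \<alpha>\<^sup>2 * (a / 2 * S) = (2 / (\<alpha> * L))\<^sup>2 * (a * l / (2 * m)) * S * L\<^sup>2 / K"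
      for l m K a S :: real
      using \<open>L > 0\<close> by (simp add: power_divide power_mult_distrib mult_ac)
    then show ?thesis unfolding c_def C_def .
  qed
  finally show "measure_pmf.expectation (pmf_of_set ?P)
      (\<lambda>p. min_subgrad_sq (finite_sum_obj n f) r (dfinito_x n f r \<alpha> \<theta> (cyclic_order n p) z0 (k * n)))
    \<le> C * L\<^sup>2 / ((real k + 1) * \<theta> * (1 - \<theta>))" .
qed

end
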